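(* Let $T$ be a rooted tree with $n$ leaves and let $v$ be a node of $T$ such that the subtree $T_v$ rooted at $v$ has exactly $\ell$ leaves. Then the query complexity (in the comparison-query model) of inversion minimization on $T$ is at least $\log_2\Gamma\!\left(\frac{\ell(n-\ell)}{n}+1\right)$. In particular, this query complexity is at least $\log_2\Gamma\!\left(\frac{k}{(k+1)^2}\,n+1\right)$, where $k$ denotes the degree of $T$.
   Context: A ranking of a set $X$ of $n$ items is a bijection $\rho:X\to\{1,\dots,n\}$. Given two rankings $\sigma,\rho$ of $X$, an inversion of $\sigma$ with respect to $\rho$ is a pair $x_1,x_2\in X$ with $\rho(x_1)<\rho(x_2)$ but $\sigma(x_1)>\sigma(x_2)$; their number is $\mathrm{Inv}_\rho(\sigma)$. An ordering of a rooted tree $T$ is a choice, at every internal node, of a left-to-right order of its children; it induces a left-to-right ranking $\sigma$ of the leaf set $X$ of $T$. For a ranking $\rho$ of $X$, $\mathrm{MInv}(T,\rho)$ is the minimum of $\mathrm{Inv}_\rho(\sigma)$ over all orderings of $T$. Inversion minimization on a fixed tree $T$ (denoted $\Pi_T$) is the problem: given a ranking $\rho$ of the leaves of $T$, output $\mathrm{MInv}(T,\rho)$. In the comparison-query model, an algorithm accesses $\rho$ only through queries "is $\rho(x_1)<\rho(x_2)$?" for $x_1,x_2\in X$; the query complexity of a problem is the minimum over correct deterministic algorithms of the maximum, over all inputs, of the number of queries made. The degree of a node is its number of children, and the degree of $T$ is the maximum degree of its nodes. $\Gamma$ is the gamma function. *)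

theory Defs
  imports "HOL-Analysis.Analysis" "HOL-Library.Multiset"
begin

text \<open>
  A rooted tree is given by one of its plane representatives; every notion below that concerns
  the unordered tree is invariant under reordering children. The leaves carry distinct labels,
  so that the leaf set is a set of labels and a node is determined by the subtree rooted at it.
\<close>

datatype 'a rtree = Leaf 'a | Node "'a rtree list"

fun leaves :: "'a rtree \<Rightarrow> 'a list" where
  "leaves (Leaf x) = [x]"
| "leaves (Node ts) = concat (map leaves ts)"

abbreviation leaf_set :: "'a rtree \<Rightarrow> 'a set" where
  "leaf_set T \<equiv> set (leaves T)"

fun nodes :: "'a rtree \<Rightarrow> 'a rtree set" where
  "nodes (Leaf x) = {Leaf x}"
| "nodes (Node ts) = insert (Node ts) (\<Union>t\<in>set ts. nodes t)"

text \<open>Childless internal nodes are excluded: a node without children is a leaf.\<close>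

definition rooted_tree :: "'a rtree \<Rightarrow> bool" where
  "rooted_tree T \<longleftrightarrow> distinct (leaves T) \<and> Node [] \<notin> nodes T"

fun node_degree :: "'a rtree \<Rightarrow> nat" where
  "node_degree (Leaf x) = 0"
| "node_degree (Node ts) = length ts"

definition tree_degree :: "'a rtree \<Rightarrow> nat" where
  "tree_degree T = Max (node_degree ` nodes T)"

text \<open>\<open>ordering_of T T'\<close>: the plane tree \<open>T'\<close> arises from \<open>T\<close> by choosing an order of the
  children at every internal node.\<close>

inductive ordering_of :: "'a rtree \<Rightarrow> 'a rtree \<Rightarrow> bool" where
  "ordering_of (Leaf x) (Leaf x)"
| "mset ss = mset ts \<Longrightarrow> list_all2 ordering_of ss us \<Longrightarrow> ordering_of (Node ts) (Node us)"

text \<open>Rankings are normalised to be \<open>undefined\<close> outside \<open>X\<close>, so that they are functions on \<open>X\<close>.\<close>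

definition rankings :: "'a set \<Rightarrow> ('a \<Rightarrow> nat) set" where
  "rankings X = {\<rho> \<in> extensional X. bij_betw \<rho> X {1..card X}}"

definition leaf_ranking :: "'a rtree \<Rightarrow> 'a \<Rightarrow> nat" where
  "leaf_ranking T = (\<lambda>x\<in>leaf_set T. Suc (length (takeWhile (\<lambda>y. y \<noteq> x) (leaves T))))"

definition Inv :: "'a set \<Rightarrow> ('a \<Rightarrow> nat) \<Rightarrow> ('a \<Rightarrow> nat) \<Rightarrow> nat" where
  "Inv X \<rho> \<sigma> = card {(x1, x2). x1 \<in> X \<and> x2 \<in> X \<and> \<rho> x1 < \<rho> x2 \<and> \<sigma> x1 > \<sigma> x2}"

definition MInv :: "'a rtree \<Rightarrow> ('a \<Rightarrow> nat) \<Rightarrow> nat" where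
  "MInv T \<rho> = Min {Inv (leaf_set T) \<rho> (leaf_ranking T') | T'. ordering_of T T'}"

text \<open>A deterministic comparison-query algorithm is a binary decision tree; \<open>Query x y A B\<close>
  asks whether \<open>\<rho> x < \<rho> y\<close> and continues with \<open>A\<close> if so and with \<open>B\<close> otherwise.\<close>

datatype ('a, 'b) algorithm =
  Output 'b
| Query 'a 'a "('a, 'b) algorithm" "('a, 'b) algorithm"

fun queries_within :: "'a set \<Rightarrow> ('a, 'b) algorithm \<Rightarrow> bool" where
  "queries_within X (Output b) \<longleftrightarrow> True"
| "queries_within X (Query x y A B) \<longleftrightarrow>
     x \<in> X \<and> y \<in> X \<and> queries_within X A \<and> queries_within X B"

fun run :: "('a, 'b) algorithm \<Rightarrow> ('a \<Rightarrow> nat) \<Rightarrow> 'b" where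
  "run (Output b) \<rho> = b"
| "run (Query x y A B) \<rho> = (if \<rho> x < \<rho> y then run A \<rho> else run B \<rho>)"

fun num_queries :: "('a, 'b) algorithm \<Rightarrow> ('a \<Rightarrow> nat) \<Rightarrow> nat" where
  "num_queries (Output b) \<rho> = 0"
| "num_queries (Query x y A B) \<rho> =
     Suc (if \<rho> x < \<rho> y then num_queries A \<rho> else num_queries B \<rho>)"

definition solves :: "('a, 'b) algorithm \<Rightarrow> 'a set \<Rightarrow> (('a \<Rightarrow> nat) \<Rightarrow> 'b) \<Rightarrow> bool" where
  "solves A X f \<longleftrightarrow> queries_within X A \<and> (\<forall>\<rho>\<in>rankings X. run A \<rho> = f \<rho>)"

definition query_complexity :: "'a set \<Rightarrow> (('a \<Rightarrow> nat) \<Rightarrow> 'b) \<Rightarrow> nat" where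
  "query_complexity X f =
     (LEAST q. \<exists>A. solves A X f \<and> q = Max (num_queries A ` rankings X))"

end

theory Submission
  imports Defs "HOL-Combinatorics.Multiset_Permutations"
begin

text \<open>
  Call a pair of adjacent ranks of \<open>\<rho>\<close> sensitive if swapping them changes \<open>MInv T \<rho>\<close>, and let
  \<open>s \<rho>\<close> be the number of sensitive pairs. An algorithm must compare every sensitive pair directly,
  so the rankings that reach a given output node are linear extensions \<open>L\<close> of a relation \<open>P\<close> with
  at least \<open>s \<rho>\<close> consecutive elements related by \<open>P\<close>. Reinserting, from the top down, every element
  that is \<open>P\<close>-below its successor at an arbitrary place among the elements above it yields at least
  \<open>(s \<rho> + 1)!\<close> permutations, and different \<open>L\<close> yield different permutations. Hence the average of
  \<open>(s \<rho> + 1)!\<close> is at most the number of output nodes, and Jensen's inequality for \<open>Gamma\<close> replaces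
  \<open>s \<rho>\<close> by its average.

  For that average, fix an optimal ordering for \<open>\<rho>\<close>. It keeps the leaves \<open>V\<close> of \<open>T\<^sub>v\<close> contiguous, so
  every maximal run of leaves outside \<open>V\<close> that \<open>\<rho>\<close> ranks between two members of \<open>V\<close> contains or
  borders an adjacent inversion, and swapping an adjacent inversion lowers the minimum. With
  \<open>t = l * (n - l) / n\<close> there are at least \<open>t - 1\<close> such runs on average, and symmetry between a
  ranking and its swap doubles the count, so \<open>s \<rho> + 1\<close> averages at least \<open>2 * t - 1\<close>. This is
  at least \<open>t\<close> unless \<open>t < 1\<close>, and then \<open>Gamma (t + 1) \<le> 1\<close>.
\<close>

section \<open>Permutations obtained from a linear extension\<close>

text \<open>The test \<open>P x y\<close> looks at the successor in the original list, not at the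
  neighbour in the rearranged tail. The number of places open to \<open>x\<close> is thus the same
  for every member of the tail's spread, and the sizes multiply.\<close>

fun spread :: "('a \<Rightarrow> 'a \<Rightarrow> bool) \<Rightarrow> 'a list \<Rightarrow> 'a list set" where
  "spread P [] = {[]}"
| "spread P [x] = {[x]}"
| "spread P (x # y # zs) =
     (if P x y then {as @ x # bs | as bs. as @ bs \<in> spread P (y # zs)}
      else (#) x ` spread P (y # zs))"

fun ascents :: "('a \<Rightarrow> 'a \<Rightarrow> bool) \<Rightarrow> 'a list \<Rightarrow> nat" where
  "ascents P (x # y # zs) = of_bool (P x y) + ascents P (y # zs)"
| "ascents P _ = 0"

lemma ascents_eq_sum:
  "ascents P xs = (\<Sum>i<length xs - 1. of_bool (P (xs ! i) (xs ! Suc i)))"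
  by (induction P xs rule: ascents.induct) (simp_all add: sum.lessThan_Suc_shift del: sum.lessThan_Suc sum_of_bool_eq)

lemma ascents_less_length: "xs \<noteq> [] \<Longrightarrow> ascents P xs < length xs"
  by (induction P xs rule: ascents.induct) auto

lemma mset_spread: "ys \<in> spread P xs \<Longrightarrow> mset ys = mset xs"
  by (induction P xs arbitrary: ys rule: spread.induct) (fastforce split: if_splits)+

lemma set_spread: "ys \<in> spread P xs \<Longrightarrow> set ys = set xs"
  by (metis mset_spread set_mset_mset)

lemma finite_spread: "finite (spread P xs)"
  by (rule finite_subset[OF _ finite_lists_length_eq[of "set xs" "length xs"]])
    (auto dest: set_spread mset_spread[THEN mset_eq_length])

text \<open>Nothing is counted twice: deleting \<open>x\<close> from the result recovers the list,
  and the part before \<open>x\<close> recovers the place. Each list of length \<open>m\<close>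
  offers \<open>m + 1\<close> places.\<close>

lemma card_insert_everywhere:
  assumes "finite S" "\<And>ys. ys \<in> S \<Longrightarrow> x \<notin> set ys \<and> length ys = m"
  shows "card {as @ x # bs | as bs. as @ bs \<in> S} = Suc m * card S"
proof -
  let ?f = "\<lambda>(i, ys). take i ys @ x # drop i ys"
  have tw: "takeWhile (\<lambda>z. z \<noteq> x) (?f (i, ys)) = take i ys"
    and fl: "filter (\<lambda>z. z \<noteq> x) (?f (i, ys)) = ys" if "x \<notin> set ys" for i ys
  proof -
    show "takeWhile (\<lambda>z. z \<noteq> x) (?f (i, ys)) = take i ys"
    proof -
      have "\<And>z. z \<in> set (take i ys) \<Longrightarrow> z \<noteq> x" using that by (auto dest: in_set_takeD)
      then show ?thesis by (simp add: takeWhile_append2)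
    qed
    have "filter (\<lambda>z. z \<noteq> x) (take i ys) = take i ys" "filter (\<lambda>z. z \<noteq> x) (drop i ys) = drop i ys"
      using that by (auto simp: filter_id_conv dest: in_set_takeD in_set_dropD)
    then show "filter (\<lambda>z. z \<noteq> x) (?f (i, ys)) = ys" by simp
  qed
  have "inj_on ?f ({..m} \<times> S)"
  proof (rule inj_onI, clarify)
    fix i ys j zs
    assume h: "i \<le> m" "ys \<in> S" "j \<le> m" "zs \<in> S" "take i ys @ x # drop i ys = take j zs @ x # drop j zs"
    then have "ys = zs" using fl[of ys i] fl[of zs j] assms(2) by (metis case_prod_conv)
    moreover have "take i ys = take j zs" using tw[of ys i] tw[of zs j] assms(2) h by (metis case_prod_conv)
    then have "i = j" using h assms(2) by (metis length_take min_absorb2)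
    ultimately show "i = j \<and> ys = zs" by simp
  qed
  moreover have "?f ` ({..m} \<times> S) = {as @ x # bs | as bs. as @ bs \<in> S}"
  proof (intro equalityI subsetI)
    fix l assume "l \<in> ?f ` ({..m} \<times> S)"
    then show "l \<in> {as @ x # bs | as bs. as @ bs \<in> S}" by force
  next
    fix l assume "l \<in> {as @ x # bs | as bs. as @ bs \<in> S}"
    then obtain as bs where l: "l = as @ x # bs" "as @ bs \<in> S" by blast
    moreover from this have "length as \<le> m" using assms(2)[of "as @ bs"] by simp
    ultimately show "l \<in> ?f ` ({..m} \<times> S)"
      by (intro image_eqI[of _ _ "(length as, as @ bs)"]) auto
  qed
  ultimately show ?thesis
    using card_image[of ?f "{..m} \<times> S"] by (simp add: card_cartesian_product)
qed

text \<open>When \<open>P x y\<close> holds, the head has \<open>length (y # zs) + 1\<close> places.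
  As there are fewer ascents than elements, this is at least \<open>ascents P (y # zs) + 2\<close>,
  the next factor of the factorial.\<close>

lemma fact_ascents_le_card_spread: "distinct xs \<Longrightarrow> fact (Suc (ascents P xs)) \<le> card (spread P xs)"
proof (induction P xs rule: spread.induct)
  case (3 P x y zs)
  have IH: "fact (Suc (ascents P (y # zs))) \<le> card (spread P (y # zs))" using 3 by auto
  show ?case
  proof (cases "P x y")
    case True
    have "fact (Suc (ascents P (x # y # zs))) \<le> Suc (length (y # zs)) * fact (Suc (ascents P (y # zs)))"
      using True ascents_less_length[of "y # zs" P] mult_le_mono1[of "Suc (Suc (ascents P (y # zs)))"]
      by (simp del: mult_Suc)
    also have "\<dots> \<le> Suc (length (y # zs)) * card (spread P (y # zs))"
      using IH by (rule mult_le_mono2)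
    also have "\<dots> = card (spread P (x # y # zs))"
    proof -
      have "x \<notin> set ys \<and> length ys = length (y # zs)" if "ys \<in> spread P (y # zs)" for ys
        using set_spread[OF that] mset_spread[OF that, THEN mset_eq_length] 3(3) by auto
      from card_insert_everywhere[OF finite_spread this] show ?thesis using True by simp
    qed
    finally show ?thesis .
  next
    case False
    then show ?thesis using IH by (simp add: card_image)
  qed
qed auto

text \<open>Since nothing else is \<open>P\<close>-below \<open>x\<close>, the predecessor of
  \<open>x\<close> was kept in front of its tail. After the deletion it has a new successor, but the
  front place is allowed whether or not that successor is \<open>P\<close>-above it. All other
  elements keep their successors.\<close>

lemma filter_spread:
  assumes "ys \<in> spread P xs" "distinct xs" "\<And>z. z \<in> set xs \<Longrightarrow> z \<noteq> x \<Longrightarrow> \<not> P z x"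
  shows "filter (\<lambda>z. z \<noteq> x) ys \<in> spread P (filter (\<lambda>z. z \<noteq> x) xs)"
  using assms
proof (induction P xs arbitrary: ys rule: spread.induct)
  case (3 P a b zs)
  define l where "l = filter (\<lambda>z. z \<noteq> x)"
  have l: "l (us @ vs) = l us @ l vs" "l (u # us) = (if u = x then l us else u # l us)" for u us vs
    by (auto simp: l_def)
  have IH: "l us \<in> spread P (l (b # zs))" if "us \<in> spread P (b # zs)" for us
    using 3 that unfolding l_def by (cases "P a b") auto
  show ?case
  proof (cases "a = x")
    case True
    have "l ys \<in> spread P (l (b # zs))"
    proof (cases "P a b")
      case True
      then obtain as bs where "ys = as @ a # bs" "as @ bs \<in> spread P (b # zs)" using 3(3) by auto
      then show ?thesis using IH[of "as @ bs"] l \<open>a = x\<close> by simp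
    next
      case False
      then show ?thesis using IH l \<open>a = x\<close> 3(3) by auto
    qed
    then show ?thesis using l(2)[of a "b # zs"] True by (simp flip: l_def)
  next
    case ax: False
    show ?thesis
    proof (cases "b = x")
      case True
      then have nP: "\<not> P a b" using ax 3(5) by auto
      then obtain us where us: "ys = a # us" "us \<in> spread P (b # zs)" using 3(3) by auto
      have lz: "l (b # zs) = zs" using True 3(4) by (auto simp: l_def filter_id_conv)
      have "l us \<in> spread P zs" using IH[OF us(2)] lz by simp
      then have "a # l us \<in> spread P (a # zs)"
        by (cases zs) (auto intro: exI[of _ "[]"])
      then show ?thesis using us lz ax l by (simp flip: l_def)
    next
      case False
      then show ?thesis
      proof (cases "P a b")
        case Pab: True
        then obtain as bs where "ys = as @ a # bs" "as @ bs \<in> spread P (b # zs)" using 3(3) by auto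
        then show ?thesis using IH[of "as @ bs"] l ax False Pab by (auto simp flip: l_def)
      next
        case nPab: False
        then show ?thesis using IH l ax False 3(3) by (auto simp flip: l_def)
      qed
    qed
  qed
qed auto

text \<open>The heads \<open>x\<close> and \<open>x'\<close> have nothing \<open>P\<close>-below
  them, so either may be deleted from all three lists and the induction hypothesis makes the
  remainders equal. If the heads differed, \<open>x'\<close> would come second in \<open>xs\<close>.
  Then \<open>x\<close> can leave the front of \<open>ys\<close> only if \<open>P x x'\<close>,
  which the order of \<open>xs'\<close> forbids. By symmetry both heads equal
  \<open>hd ys\<close>.\<close>

lemma spread_disjoint:
  assumes "ys \<in> spread P xs" "ys \<in> spread P xs'"
    and "distinct xs" "distinct xs'" "set xs = set xs'"
    and "sorted_wrt (\<lambda>x y. \<not> P y x) xs" "sorted_wrt (\<lambda>x y. \<not> P y x) xs'"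
  shows "xs = xs'"
  using assms
proof (induction "length xs" arbitrary: xs xs' ys)
  case 0
  then show ?case by simp
next
  case (Suc n)
  obtain x t where xs: "xs = x # t" using Suc(2) by (cases xs) auto
  obtain x' t' where xs': "xs' = x' # t'" using Suc xs by (cases xs') auto
  have reduce: "filter (\<lambda>z. z \<noteq> u) xs = filter (\<lambda>z. z \<noteq> u) xs'" if "u = x \<or> u = x'" for u
  proof (rule Suc(1))
    have min: "\<not> P z u" if "z \<in> set xs" "z \<noteq> u" for z
      using Suc(7-9) xs xs' that \<open>u = x \<or> u = x'\<close> by auto
    show "filter (\<lambda>z. z \<noteq> u) ys \<in> spread P (filter (\<lambda>z. z \<noteq> u) xs)"
      using min by (intro filter_spread Suc) auto
    show "filter (\<lambda>z. z \<noteq> u) ys \<in> spread P (filter (\<lambda>z. z \<noteq> u) xs')"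
      using min Suc(7) by (intro filter_spread Suc) auto
    have "u \<in> set xs" using that xs xs' Suc(7) by auto
    have "length (filter (\<lambda>z. z \<noteq> u) xs) = card (set xs - {u})"
      using Suc(5) by (metis distinct_card distinct_filter set_minus_filter_out)
    then show "n = length (filter (\<lambda>z. z \<noteq> u) xs)"
      using \<open>u \<in> set xs\<close> Suc(2,5) by (simp add: distinct_card)
  qed (use Suc in \<open>auto intro: sorted_wrt_filter\<close>)
  have head: "x = hd ys" if ne: "x \<noteq> x'"
  proof (rule ccontr)
    assume "x \<noteq> hd ys"
    obtain y zs where t: "t = y # zs" using ne xs xs' Suc(7) by (cases t) auto
    then have "P x y" using \<open>x \<noteq> hd ys\<close> Suc(3) xs by (auto split: if_splits)
    moreover have "y = x'"
      using reduce[of x] that xs xs' t Suc(5) by auto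
    ultimately show False using Suc(7,9) xs xs' that by auto
  qed
  have head': "x' = hd ys" if ne: "x \<noteq> x'"
  proof (rule ccontr)
    assume "x' \<noteq> hd ys"
    obtain y zs where t: "t' = y # zs" using ne xs xs' Suc(7) by (cases t') auto
    then have "P x' y" using \<open>x' \<noteq> hd ys\<close> Suc(4) xs' by (auto split: if_splits)
    moreover have "y = x"
      using reduce[of x'] that xs xs' t Suc(6) by auto
    ultimately show False using Suc(7,8) xs xs' that by auto
  qed
  have "x = x'" using head head' by blast
  moreover have "filter (\<lambda>z. z \<noteq> x) xs = t" "filter (\<lambda>z. z \<noteq> x') xs' = t'"
    using xs xs' Suc(5,6) by (auto simp: filter_id_conv)
  ultimately show ?case using reduce[of x] xs xs' by simp
qed

text \<open>The spreads of different linear extensions are disjoint sets of permutations of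
  \<open>X\<close>, so their sizes add up to at most \<open>fact (card X)\<close>.\<close>

lemma sum_fact_ascents_le:
  assumes "finite X" "S \<subseteq> permutations_of_set X"
    and "\<And>xs. xs \<in> S \<Longrightarrow> sorted_wrt (\<lambda>x y. \<not> P y x) xs"
  shows "(\<Sum>xs\<in>S. fact (Suc (ascents P xs))) \<le> (fact (card X) :: nat)"
proof -
  have fin: "finite S" using assms(1,2) finite_subset by fastforce
  have S: "distinct xs" "set xs = X" if "xs \<in> S" for xs
    using that assms(2) by (auto simp: permutations_of_set_def)
  have "(\<Sum>xs\<in>S. fact (Suc (ascents P xs))) \<le> (\<Sum>xs\<in>S. card (spread P xs))"
    using S by (intro sum_mono fact_ascents_le_card_spread) auto
  also have "\<dots> = card (\<Union>xs\<in>S. spread P xs)"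
  proof (rule card_UN_disjoint[symmetric, OF fin])
    show "\<forall>xs\<in>S. \<forall>xs'\<in>S. xs \<noteq> xs' \<longrightarrow> spread P xs \<inter> spread P xs' = {}"
      using S assms(3) spread_disjoint[where P = P] by (metis disjoint_iff)
  qed (simp add: finite_spread)
  also have "\<dots> \<le> card (permutations_of_set X)"
  proof (rule card_mono)
    show "(\<Union>xs\<in>S. spread P xs) \<subseteq> permutations_of_set X"
      using S by (auto simp: permutations_of_set_def dest: set_spread)
        (metis mset_spread mset_eq_imp_distinct_iff)
  qed simp
  also have "\<dots> = fact (card X)" using assms(1) by simp
  finally show ?thesis .
qed

section \<open>Sensitivity and decision trees\<close>

definition item :: "'a set \<Rightarrow> ('a \<Rightarrow> nat) \<Rightarrow> nat \<Rightarrow> 'a" where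
  "item X \<rho> = inv_into X \<rho>"

text \<open>Restricting to \<open>X\<close> keeps the result extensional, as membership in
  \<open>rankings X\<close> requires.\<close>

definition relabel :: "'a set \<Rightarrow> (nat \<Rightarrow> nat) \<Rightarrow> ('a \<Rightarrow> nat) \<Rightarrow> 'a \<Rightarrow> nat" where
  "relabel X p \<rho> = (\<lambda>x\<in>X. p (\<rho> x))"

abbreviation swap :: "'a set \<Rightarrow> nat \<Rightarrow> ('a \<Rightarrow> nat) \<Rightarrow> 'a \<Rightarrow> nat" where
  "swap X k \<equiv> relabel X (Transposition.transpose k (Suc k))"

lemma rankingsD:
  assumes "\<rho> \<in> rankings X"
  shows "inj_on \<rho> X" "\<rho> ` X = {1..card X}" "\<rho> \<in> extensional X"
  using assms by (auto simp: rankings_def bij_betw_def)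

lemma finite_rankings:
  assumes "finite X"
  shows "finite (rankings X)"
proof (rule finite_subset)
  show "rankings X \<subseteq> X \<rightarrow>\<^sub>E {1..card X}"
    by (auto simp: rankings_def bij_betw_def PiE_def)
  show "finite (X \<rightarrow>\<^sub>E {1..card X})" using assms by (intro finite_PiE) auto
qed

lemma item_in: "\<rho> \<in> rankings X \<Longrightarrow> k \<in> {1..card X} \<Longrightarrow> item X \<rho> k \<in> X"
  unfolding item_def by (metis inv_into_into rankingsD(2))

lemma ranking_item: "\<rho> \<in> rankings X \<Longrightarrow> k \<in> {1..card X} \<Longrightarrow> \<rho> (item X \<rho> k) = k"
  unfolding item_def by (metis f_inv_into_f rankingsD(2))

lemma item_ranking: "\<rho> \<in> rankings X \<Longrightarrow> x \<in> X \<Longrightarrow> item X \<rho> (\<rho> x) = x"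
  unfolding item_def by (simp add: rankingsD)

lemma ranking_in: "\<rho> \<in> rankings X \<Longrightarrow> x \<in> X \<Longrightarrow> \<rho> x \<in> {1..card X}"
  using rankingsD(2) by blast

lemma item_eq_iff:
  "\<rho> \<in> rankings X \<Longrightarrow> k \<in> {1..card X} \<Longrightarrow> x \<in> X \<Longrightarrow> item X \<rho> k = x \<longleftrightarrow> \<rho> x = k"
  using ranking_item item_ranking by metis

lemma relabel_in_rankings:
  assumes "\<rho> \<in> rankings X" "p permutes {1..card X}"
  shows "relabel X p \<rho> \<in> rankings X"
proof -
  have "bij_betw (p \<circ> \<rho>) X {1..card X}"
    using assms bij_betw_trans[of \<rho> X "{1..card X}" p "{1..card X}"]
    by (auto simp: rankings_def permutes_imp_bij)
  then show ?thesis by (auto simp: rankings_def relabel_def cong: bij_betw_cong)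
qed

lemma relabel_relabel: "relabel X p (relabel X q \<rho>) = relabel X (p \<circ> q) \<rho>"
  by (auto simp: relabel_def)

lemma relabel_id: "\<rho> \<in> rankings X \<Longrightarrow> relabel X id \<rho> = \<rho>"
  by (auto simp: relabel_def rankings_def extensional_def)

lemma inj_on_relabel:
  assumes "p permutes {1..card X}"
  shows "inj_on (relabel X p) (rankings X)"
proof (rule inj_on_inverseI)
  fix \<rho> assume "\<rho> \<in> rankings X"
  then show "relabel X (inv p) (relabel X p \<rho>) = \<rho>"
    using permutes_inv_o(2)[OF assms] by (simp add: relabel_relabel relabel_id)
qed

lemma swap_permutes: "k \<in> {1..<n} \<Longrightarrow> Transposition.transpose k (Suc k) permutes {1..n}"
  by (intro permutes_swap_id) auto

lemma swap_in_rankings: "\<rho> \<in> rankings X \<Longrightarrow> k \<in> {1..<card X} \<Longrightarrow> swap X k \<rho> \<in> rankings X"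
  by (intro relabel_in_rankings swap_permutes)

lemma swap_swap: "\<rho> \<in> rankings X \<Longrightarrow> swap X k (swap X k \<rho>) = \<rho>"
  by (simp add: relabel_relabel relabel_id)

text \<open>No rank lies between \<open>k\<close> and \<open>k + 1\<close>, so the swap affects only
  the comparison of the two items holding these ranks.\<close>

lemma swap_less_iff:
  assumes "\<rho> \<in> rankings X" "k \<in> {1..<card X}" "x \<in> X" "y \<in> X"
    and "{x, y} \<noteq> {item X \<rho> k, item X \<rho> (Suc k)}"
  shows "swap X k \<rho> x < swap X k \<rho> y \<longleftrightarrow> \<rho> x < \<rho> y"
proof -
  have "\<not> (\<rho> x = k \<and> \<rho> y = Suc k)" "\<not> (\<rho> y = k \<and> \<rho> x = Suc k)"
    using assms item_ranking[OF assms(1), of x] item_ranking[OF assms(1), of y] by auto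
  then show ?thesis using assms(3,4) by (auto simp: relabel_def Transposition.transpose_def)
qed

text \<open>Relabelling one fixed ranking by different permutations of the ranks gives different
  rankings.\<close>

lemma card_rankings_ge:
  assumes "finite X"
  shows "fact (card X) \<le> card (rankings X)"
proof -
  obtain h where "bij_betw h X {1..card X}"
    using finite_same_card_bij[of X "{1..card X}"] assms by auto
  then have \<rho>: "restrict h X \<in> rankings X" by (auto simp: rankings_def cong: bij_betw_cong)
  have "card {p. p permutes {1..card X}} \<le> card (rankings X)"
  proof (rule card_inj_on_le)
    show "inj_on (\<lambda>p. relabel X p (restrict h X)) {p. p permutes {1..card X}}"
    proof (rule inj_onI, clarify)
      fix p q assume pq: "p permutes {1..card X}" "q permutes {1..card X}"
        and eq: "relabel X p (restrict h X) = relabel X q (restrict h X)"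
      have "p i = q i" if "i \<in> {1..card X}" for i
        using fun_cong[OF eq, of "item X (restrict h X) i"] item_in[OF \<rho> that] ranking_item[OF \<rho> that]
        by (simp add: relabel_def)
      moreover have "p i = q i" if "i \<notin> {1..card X}" for i
        using that pq by (metis permutes_not_in)
      ultimately show "p = q" by blast
    qed
  qed (use \<rho> relabel_in_rankings finite_rankings[OF assms] in auto)
  then show ?thesis by (simp add: card_permutations)
qed

section \<open>Decision trees: transcripts and what they reveal\<close>

fun answers :: "('a, 'b) algorithm \<Rightarrow> ('a \<Rightarrow> nat) \<Rightarrow> bool list" where
  "answers (Output b) \<rho> = []"
| "answers (Query x y A B) \<rho> = (\<rho> x < \<rho> y) # (if \<rho> x < \<rho> y then answers A \<rho> else answers B \<rho>)"

text \<open>Pairs point from the lower to the higher rank. A negative answer records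
  \<open>(y, x)\<close>, which is exact only up to equality, as for a query of an item against
  itself; hence the weak inequality in \<open>learned_le\<close>.\<close>

fun learned :: "('a, 'b) algorithm \<Rightarrow> ('a \<Rightarrow> nat) \<Rightarrow> ('a \<times> 'a) set" where
  "learned (Output b) \<rho> = {}"
| "learned (Query x y A B) \<rho> =
     (if \<rho> x < \<rho> y then insert (x, y) (learned A \<rho>) else insert (y, x) (learned B \<rho>))"

lemma learned_cong: "answers A \<rho> = answers A \<rho>' \<Longrightarrow> learned A \<rho> = learned A \<rho>'"
  by (induction A) (auto split: if_splits)

lemma learned_le: "(x, y) \<in> learned A \<rho> \<Longrightarrow> \<rho> x \<le> \<rho> y"
  by (induction A) (auto split: if_splits)

text \<open>Had the two items been compared in either order, their ranks would have forced exactly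
  this pair to be recorded. So the run asks only questions whose answers survive the swap, and both
  inputs follow the same path.\<close>

lemma run_swap:
  assumes "\<rho> \<in> rankings X" "k \<in> {1..<card X}" "queries_within X A"
    and "(item X \<rho> k, item X \<rho> (Suc k)) \<notin> learned A \<rho>"
  shows "run A (swap X k \<rho>) = run A \<rho>"
  using assms(3,4)
proof (induction A)
  case (Query x y A B)
  have "\<rho> (item X \<rho> k) = k" "\<rho> (item X \<rho> (Suc k)) = Suc k"
    using assms(1,2) by (auto intro!: ranking_item)
  then have "{x, y} \<noteq> {item X \<rho> k, item X \<rho> (Suc k)}"
    using Query.prems(2) by (auto simp: doubleton_eq_iff)
  then have "swap X k \<rho> x < swap X k \<rho> y \<longleftrightarrow> \<rho> x < \<rho> y"
    using Query.prems(1) by (intro swap_less_iff assms) auto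
  then show ?case using Query by (auto split: if_splits)
qed simp

text \<open>The induction splits \<open>R\<close> by the first answer. The depth bound therefore
  concerns only paths taken by members of \<open>R\<close>; branches reached by none may be
  deeper.\<close>

lemma card_answers_le:
  assumes "finite R" "\<And>\<rho>. \<rho> \<in> R \<Longrightarrow> num_queries A \<rho> \<le> q"
  shows "card (answers A ` R) \<le> 2 ^ q"
  using assms
proof (induction A arbitrary: R q)
  case (Output b)
  have "answers (Output b) ` R \<subseteq> {[]}" by auto
  then have "card (answers (Output b) ` R) \<le> 1" using card_mono[of "{[]::bool list}"] by fastforce
  then show ?case using order_trans one_le_power[of "2::nat"] by (metis one_le_numeral)
next
  case (Query x y A B)
  show ?case
  proof (cases "R = {}")
    case False
    then obtain q' where q: "q = Suc q'" using Query.prems(2) by (cases q) force+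
    let ?R1 = "{\<rho> \<in> R. \<rho> x < \<rho> y}" and ?R2 = "{\<rho> \<in> R. \<not> \<rho> x < \<rho> y}"
    have A: "num_queries A \<rho> \<le> q'" if "\<rho> \<in> ?R1" for \<rho> using Query.prems(2)[of \<rho>] that q by auto
    have B: "num_queries B \<rho> \<le> q'" if "\<rho> \<in> ?R2" for \<rho> using Query.prems(2)[of \<rho>] that q by auto
    have "R = ?R1 \<union> ?R2" by auto
    then have "answers (Query x y A B) ` R = answers (Query x y A B) ` ?R1 \<union> answers (Query x y A B) ` ?R2"
      by (metis image_Un)
    also have "\<dots> = (#) True ` answers A ` ?R1 \<union> (#) False ` answers B ` ?R2"
      unfolding image_image by (intro arg_cong2[where f = "(\<union>)"] image_cong) auto
    finally have img: "answers (Query x y A B) ` R = (#) True ` answers A ` ?R1 \<union> (#) False ` answers B ` ?R2" .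
    have "card (answers (Query x y A B) ` R)
        \<le> card ((#) True ` answers A ` ?R1) + card ((#) False ` answers B ` ?R2)"
      unfolding img by (rule card_Un_le)
    also have "\<dots> \<le> 2 ^ q' + 2 ^ q'"
      using Query.IH(1)[of ?R1 q', OF _ A] Query.IH(2)[of ?R2 q', OF _ B] Query.prems(1)
      by (intro add_mono) (simp_all add: card_image)
    finally show ?thesis using q by simp
  qed simp
qed

text \<open>The degree of \<open>\<rho>\<close> in the graph that joins two rankings if they differ
  by an adjacent swap and have different values of \<open>f\<close>.\<close>

definition sensitivity :: "'a set \<Rightarrow> (('a \<Rightarrow> nat) \<Rightarrow> 'b) \<Rightarrow> ('a \<Rightarrow> nat) \<Rightarrow> nat" where
  "sensitivity X f \<rho> = card {k \<in> {1..<card X}. f (swap X k \<rho>) \<noteq> f \<rho>}"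

lemma sensitivity_lemma:
  assumes "finite X" "solves A X f" "\<And>\<rho>. \<rho> \<in> rankings X \<Longrightarrow> num_queries A \<rho> \<le> q"
  shows "(\<Sum>\<rho>\<in>rankings X. fact (Suc (sensitivity X f \<rho>))) \<le> (2 ^ q * fact (card X) :: nat)"
proof -
  let ?R = "rankings X" and ?n = "card X"
  \<comment> \<open>List positions start at 0 and ranks at 1, hence the \<open>Suc\<close>.\<close>
  define order where "order \<rho> = map (\<lambda>i. item X \<rho> (Suc i)) [0..<?n]" for \<rho>
  have nth: "order \<rho> ! i = item X \<rho> (Suc i)" if "i < ?n" for \<rho> i
    using that by (simp add: order_def)
  have len: "length (order \<rho>) = ?n" for \<rho> by (simp add: order_def)
  have perm: "order \<rho> \<in> permutations_of_set X" if \<rho>: "\<rho> \<in> ?R" for \<rho>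
  proof -
    have "inj_on (\<lambda>i. item X \<rho> (Suc i)) {0..<?n}"
      by (rule inj_on_inverseI[of _ "\<lambda>x. \<rho> x - 1"]) (simp add: ranking_item[OF \<rho>])
    then have d: "distinct (order \<rho>)" by (simp add: order_def distinct_map)
    have "set (order \<rho>) \<subseteq> X" using item_in[OF \<rho>] by (auto simp: order_def)
    then have "set (order \<rho>) = X"
      using d len assms(1) by (metis card_subset_eq distinct_card)
    then show ?thesis using d by (simp add: permutations_of_set_def)
  qed
  have inj: "inj_on order ?R"
  proof (rule inj_onI)
    fix \<rho> \<rho>' assume \<rho>: "\<rho> \<in> ?R" "\<rho>' \<in> ?R" and eq: "order \<rho> = order \<rho>'"
    show "\<rho> = \<rho>'"
    proof (rule extensionalityI[OF rankingsD(3)[OF \<rho>(1)] rankingsD(3)[OF \<rho>(2)]])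
      fix x assume x: "x \<in> X"
      have k: "\<rho> x \<in> {1..?n}" using ranking_in[OF \<rho>(1) x] .
      then have "item X \<rho> (\<rho> x) = item X \<rho>' (\<rho> x)"
        using nth[of "\<rho> x - 1" \<rho>] nth[of "\<rho> x - 1" \<rho>'] eq
        by (cases "\<rho> x") auto
      then show "\<rho> x = \<rho>' x" using item_ranking[OF \<rho>(1) x] ranking_item[OF \<rho>(2) k] by simp
    qed
  qed
  \<comment> \<open>A transcript \<open>a\<close> identifies an output node, so this is the
    contribution of a single output node. There are at most \<open>2 ^ q\<close> of them.\<close>
  have one: "(\<Sum>\<rho> | \<rho> \<in> ?R \<and> answers A \<rho> = a. fact (Suc (sensitivity X f \<rho>))) \<le> (fact ?n :: nat)" (is "sum _ ?C \<le> _")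
    for a
  proof (cases "?C = {}")
    case False
    then obtain \<rho>0 where \<rho>0: "\<rho>0 \<in> ?C" by auto
    \<comment> \<open>All rankings with the same transcript learn the same relation, so any
      representative will do.\<close>
    define P where "P x y \<longleftrightarrow> (x, y) \<in> learned A \<rho>0" for x y
    have P: "P x y \<longleftrightarrow> (x, y) \<in> learned A \<rho>" if "\<rho> \<in> ?C" for \<rho> x y
      using that \<rho>0 learned_cong[of A \<rho> \<rho>0] by (auto simp: P_def)
    have sens: "sensitivity X f \<rho> \<le> ascents P (order \<rho>)" if \<rho>: "\<rho> \<in> ?C" for \<rho>
    proof -
      have R: "\<rho> \<in> ?R" using \<rho> by auto
      \<comment> \<open>If the pair had not been learned, the outputs on \<open>\<rho>\<close> and
        on its swap would agree, although \<open>f\<close> differs there.\<close>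
      have "P (item X \<rho> k) (item X \<rho> (Suc k))" if k: "k \<in> {1..<?n}" "f (swap X k \<rho>) \<noteq> f \<rho>" for k
        using run_swap[OF R k(1), of A] assms(2) k(2) P[OF \<rho>] swap_in_rankings[OF R k(1)] R
        by (auto simp: solves_def)
      then have "{k \<in> {1..<?n}. f (swap X k \<rho>) \<noteq> f \<rho>}
          \<subseteq> Suc ` {i \<in> {..<?n - 1}. P (order \<rho> ! i) (order \<rho> ! Suc i)}"
        using nth by (fastforce simp: image_iff dest: Suc_le_D)
      then have "sensitivity X f \<rho> \<le> card (Suc ` {i \<in> {..<?n - 1}. P (order \<rho> ! i) (order \<rho> ! Suc i)})"
        unfolding sensitivity_def by (intro card_mono) auto
      also have "\<dots> = ascents P (order \<rho>)"
        by (simp add: ascents_eq_sum len card_image Int_def)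
      finally show ?thesis .
    qed
    have "(\<Sum>\<rho>\<in>?C. fact (Suc (sensitivity X f \<rho>))) \<le> (\<Sum>\<rho>\<in>?C. fact (Suc (ascents P (order \<rho>))) :: nat)"
      using sens by (intro sum_mono fact_mono) auto
    also have "\<dots> = (\<Sum>xs\<in>order ` ?C. fact (Suc (ascents P xs)))"
      by (subst sum.reindex) (auto intro: inj_on_subset[OF inj])
    also have "\<dots> \<le> fact ?n"
    proof (rule sum_fact_ascents_le[OF assms(1)])
      show "order ` ?C \<subseteq> permutations_of_set X" using perm by auto
      fix xs assume "xs \<in> order ` ?C"
      then obtain \<rho> where \<rho>: "\<rho> \<in> ?C" "xs = order \<rho>" by auto
      have "\<not> P (xs ! j) (xs ! i)" if "i < j" "j < length xs" for i j
        using that learned_le[of "xs ! j" "xs ! i" A \<rho>] P[OF \<rho>(1)] \<rho> ranking_item[of \<rho> X]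
        by (auto simp: nth len)
      then show "sorted_wrt (\<lambda>x y. \<not> P y x) xs" by (simp add: sorted_wrt_iff_nth_less)
    qed
    finally show ?thesis .
  next
    case True
    show ?thesis unfolding True by simp
  qed
  have "(\<Sum>\<rho>\<in>?R. fact (Suc (sensitivity X f \<rho>)) :: nat)
      = (\<Sum>a\<in>answers A ` ?R. \<Sum>\<rho> | \<rho> \<in> ?R \<and> answers A \<rho> = a. fact (Suc (sensitivity X f \<rho>)))"
    by (rule sum.image_gen[OF finite_rankings[OF assms(1)]])
  also have "\<dots> \<le> card (answers A ` ?R) * fact ?n"
    using one by (intro sum_bounded_above[where K = "fact ?n :: nat", simplified]) auto
  also have "\<dots> \<le> 2 ^ q * fact ?n"
    using card_answers_le[OF finite_rankings[OF assms(1)], of A q] assms(3) by simp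
  finally show ?thesis .
qed

section \<open>The average sensitivity of separated families\<close>

text \<open>The inverted pair at ranks \<open>k\<close> and \<open>k + 1\<close> disappears, and no
  other comparison changes.\<close>

lemma Inv_swap:
  assumes "finite X" "\<rho> \<in> rankings X" "k \<in> {1..<card X}"
    and "\<sigma> (item X \<rho> (Suc k)) < \<sigma> (item X \<rho> k)"
  shows "Inv X \<rho> \<sigma> = Suc (Inv X (swap X k \<rho>) \<sigma>)"
proof -
  let ?x = "item X \<rho> k" and ?y = "item X \<rho> (Suc k)"
  let ?I = "\<lambda>\<rho>. {(a, b). a \<in> X \<and> b \<in> X \<and> \<rho> a < \<rho> b \<and> \<sigma> b < \<sigma> a}"
  have k: "k \<in> {1..card X}" "Suc k \<in> {1..card X}" using assms(3) by auto
  note xX = item_in[OF assms(2) k(1)] and yX = item_in[OF assms(2) k(2)]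
  note rx = ranking_item[OF assms(2) k(1)] and ry = ranking_item[OF assms(2) k(2)]
  have not: "\<not> swap X k \<rho> ?x < swap X k \<rho> ?y"
    using xX yX rx ry by (simp add: relabel_def)
  have iff: "(a, b) \<in> ?I \<rho> \<longleftrightarrow> (a, b) = (?x, ?y) \<or> (a, b) \<in> ?I (swap X k \<rho>)" for a b
  proof (cases "a \<in> X \<and> b \<in> X \<and> \<sigma> b < \<sigma> a")
    case ab: True
    show ?thesis
    proof (cases "(a, b) = (?x, ?y)")
      case True
      then show ?thesis using xX yX rx ry assms(4) by simp
    next
      case False
      then have "{a, b} \<noteq> {?x, ?y}" using ab assms(4) by (auto simp: doubleton_eq_iff)
      from swap_less_iff[OF assms(2,3) _ _ this] ab False show ?thesis by auto
    qed
  qed (use xX yX assms(4) in auto)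
  have "?I \<rho> = insert (?x, ?y) (?I (swap X k \<rho>))" using iff by (auto simp only: prod.collapse)
  moreover have "finite (?I (swap X k \<rho>))"
    by (rule finite_subset[of _ "X \<times> X"]) (use assms(1) in auto)
  moreover have "(?x, ?y) \<notin> ?I (swap X k \<rho>)" using not by simp
  ultimately show ?thesis unfolding Inv_def by simp
qed

text \<open>Between two consecutive members of \<open>V\<close>, a run of elements outside \<open>V\<close> cannot be
  \<open>\<sigma>\<close>-increasing including its two boundaries, as it would start above and end below \<open>V\<close>.\<close>

lemma card_descents_ge:
  assumes "\<rho> \<in> rankings X"
    and "\<And>y. y \<in> X - V \<Longrightarrow> (\<forall>x\<in>V. \<sigma> y < \<sigma> x) \<or> (\<forall>x\<in>V. \<sigma> x < (\<sigma> y :: nat))"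
  shows "card {k \<in> {1..<card X}. item X \<rho> k \<notin> V \<and> item X \<rho> (Suc k) \<in> V}
    \<le> Suc (card {k \<in> {1..<card X}. \<sigma> (item X \<rho> (Suc k)) < \<sigma> (item X \<rho> k)})"
proof (cases "card X = 0")
  case False
  let ?K = "{1..<card X}"
  \<comment> \<open>\<open>l\<close> is a potential marking items outside and below
    \<open>V\<close>. Its value rises only at a descent; a run entering \<open>V\<close> from above
    ends in a descent, and one entering from below spends the potential. The differences telescope,
    and the initial value \<open>l 1 \<le> 1\<close> accounts for the \<open>Suc\<close> in the
    bound.\<close>
  define l :: "nat \<Rightarrow> int" where
    "l k = of_bool (item X \<rho> k \<notin> V \<and> (\<forall>x\<in>V. \<sigma> (item X \<rho> k) < \<sigma> x))" for k
  define d :: "nat \<Rightarrow> int" where "d k = of_bool (item X \<rho> k \<notin> V \<and> item X \<rho> (Suc k) \<in> V)" for k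
  define e :: "nat \<Rightarrow> int" where "e k = of_bool (\<sigma> (item X \<rho> (Suc k)) < \<sigma> (item X \<rho> k))" for k
  have "d k + (l (Suc k) - l k) \<le> e k" if "k \<in> ?K" for k
  proof -
    have "item X \<rho> k \<in> X" "item X \<rho> (Suc k) \<in> X"
      using that by (auto intro!: item_in[OF assms(1)])
    then have "item X \<rho> k \<in> V \<or> (\<forall>x\<in>V. \<sigma> (item X \<rho> k) < \<sigma> x) \<or> (\<forall>x\<in>V. \<sigma> x < \<sigma> (item X \<rho> k))"
      using assms(2) by blast
    then show ?thesis unfolding d_def l_def e_def
      by (auto simp: of_bool_def)
  qed
  then have "(\<Sum>k\<in>?K. d k + (l (Suc k) - l k)) \<le> (\<Sum>k\<in>?K. e k)" by (rule sum_mono)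
  moreover have "(\<Sum>k\<in>?K. l (Suc k) - l k) = l (card X) - l 1"
    using False by (intro sum_Suc_diff') auto
  moreover have "l 1 \<le> 1" "0 \<le> l (card X)" by (simp_all add: l_def)
  ultimately have "(\<Sum>k\<in>?K. d k) \<le> (\<Sum>k\<in>?K. e k) + 1" by (simp add: sum.distrib)
  moreover have "(\<Sum>k\<in>?K. d k) = int (card {k \<in> ?K. item X \<rho> k \<notin> V \<and> item X \<rho> (Suc k) \<in> V})"
    by (simp add: d_def Int_def)
  moreover have "(\<Sum>k\<in>?K. e k) = int (card {k \<in> ?K. \<sigma> (item X \<rho> (Suc k)) < \<sigma> (item X \<rho> k)})"
    by (simp add: e_def Int_def)
  ultimately show ?thesis by simp
qed simp

text \<open>Group the rankings by the pair of ranks \<open>(\<rho> y, \<rho> x)\<close>. There are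
  \<open>card X * (card X - 1)\<close> possible pairs, and a suitable relabelling injects each group
  into the one for \<open>(k, Suc k)\<close>.\<close>

lemma card_rankings_consecutive:
  assumes "finite X" "x \<in> X" "y \<in> X" "x \<noteq> y" "k \<in> {1..<card X}"
  shows "card (rankings X)
    \<le> card X * (card X - 1) * card {\<rho> \<in> rankings X. \<rho> y = k \<and> \<rho> x = Suc k}"
proof -
  let ?R = "rankings X" and ?N = "{1..card X}"
  let ?C = "\<lambda>(i, j). {\<rho> \<in> ?R. \<rho> y = i \<and> \<rho> x = j}"
  let ?I = "SIGMA i:?N. ?N - {i}"
  have k: "k \<in> ?N" "Suc k \<in> ?N" using assms(5) by auto
  have le: "card (?C (i, j)) \<le> card (?C (k, Suc k))" if ij: "(i, j) \<in> ?I" for i j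
  proof -
    \<comment> \<open>First \<open>i\<close> is sent to \<open>k\<close>, then the resulting image
      of \<open>j\<close> to \<open>Suc k\<close>; the second transposition fixes \<open>k\<close>
      because \<open>i\<close> and \<open>j\<close> differ.\<close>
    define p where "p = Transposition.transpose (Transposition.transpose i k j) (Suc k)
      \<circ> Transposition.transpose i k"
    have t: "Transposition.transpose i k permutes ?N" using ij k by (intro permutes_swap_id) auto
    then have "Transposition.transpose i k j \<in> ?N" using ij by (subst permutes_in_image) auto
    then have p: "p permutes ?N"
      unfolding p_def using k by (intro permutes_compose[OF t] permutes_swap_id)
    have "p i = k" "p j = Suc k" using ij by (auto simp: p_def Transposition.transpose_def)
    then have "relabel X p ` ?C (i, j) \<subseteq> ?C (k, Suc k)"
      using assms(2,3) relabel_in_rankings[OF _ p] by (auto simp: relabel_def)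
    then show ?thesis
      using finite_rankings[OF assms(1)]
      by (intro card_inj_on_le[OF inj_on_subset[OF inj_on_relabel[OF p]]]) auto
  qed
  have "?R \<subseteq> (\<Union>ij\<in>?I. ?C ij)"
  proof
    fix \<rho> assume \<rho>: "\<rho> \<in> ?R"
    then have "\<rho> x \<noteq> \<rho> y" using assms rankingsD(1)[OF \<rho>] by (auto dest: inj_onD)
    then show "\<rho> \<in> (\<Union>ij\<in>?I. ?C ij)"
      using \<rho> ranking_in[OF \<rho> assms(2)] ranking_in[OF \<rho> assms(3)]
      by (intro UN_I[of "(\<rho> y, \<rho> x)"]) auto
  qed
  then have "card ?R \<le> card (\<Union>ij\<in>?I. ?C ij)"
    by (intro card_mono finite_UN_I) (auto simp: finite_rankings[OF assms(1)])
  also have "\<dots> \<le> (\<Sum>ij\<in>?I. card (?C ij))" by (intro card_UN_le) auto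
  also have "\<dots> \<le> (\<Sum>ij\<in>?I. card (?C (k, Suc k)))"
    by (intro sum_mono) (use le in fast)
  also have "\<dots> = card ?I * card (?C (k, Suc k))" by simp
  also have "card ?I = card X * (card X - 1)" by simp
  finally show ?thesis by simp
qed

text \<open>Sum the preceding bound over all \<open>x\<close> in \<open>V\<close> and
  \<open>y\<close> outside. Injectivity of rankings makes the events for different pairs disjoint.
  In probabilistic terms, rank \<open>k\<close> is the end of a run outside \<open>V\<close> with
  probability at least \<open>l * (n - l) / (n * (n - 1))\<close>, where \<open>n = card X\<close>
  and \<open>l = card V\<close>.\<close>

lemma card_boundary_rankings:
  assumes "finite X" "V \<subseteq> X" "k \<in> {1..<card X}"
  shows "card V * card (X - V) * card (rankings X)
    \<le> card X * (card X - 1) * card {\<rho> \<in> rankings X. item X \<rho> k \<notin> V \<and> item X \<rho> (Suc k) \<in> V}"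
proof -
  let ?R = "rankings X" and ?c = "card X * (card X - 1)"
  let ?C = "\<lambda>(x, y). {\<rho> \<in> ?R. \<rho> y = k \<and> \<rho> x = Suc k}"
  have fin: "finite V" "finite (X - V)" using assms finite_subset by auto
  have k: "k \<in> {1..card X}" "Suc k \<in> {1..card X}" using assms(3) by auto
  have "card V * card (X - V) * card ?R = (\<Sum>xy\<in>V \<times> (X - V). card ?R)"
    by (simp add: card_cartesian_product)
  also have "\<dots> \<le> (\<Sum>xy\<in>V \<times> (X - V). ?c * card (?C xy))"
  proof (rule sum_mono)
    fix xy assume "xy \<in> V \<times> (X - V)"
    then obtain x y where "xy = (x, y)" "x \<in> X" "y \<in> X" "x \<noteq> y" using assms(2) by auto
    then show "card ?R \<le> ?c * card (?C xy)"
      using card_rankings_consecutive[OF assms(1) _ _ _ assms(3), of x y] by simp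
  qed
  also have "\<dots> = ?c * (\<Sum>xy\<in>V \<times> (X - V). card (?C xy))" by (simp add: sum_distrib_left)
  also have "(\<Sum>xy\<in>V \<times> (X - V). card (?C xy)) = card (\<Union>xy\<in>V \<times> (X - V). ?C xy)"
  proof (rule card_UN_disjoint[symmetric])
    show "\<forall>p\<in>V \<times> (X - V). \<forall>q\<in>V \<times> (X - V). p \<noteq> q \<longrightarrow> ?C p \<inter> ?C q = {}"
    proof (intro ballI impI, rule ccontr)
      fix p q assume pq: "p \<in> V \<times> (X - V)" "q \<in> V \<times> (X - V)" "p \<noteq> q" and "?C p \<inter> ?C q \<noteq> {}"
      then obtain \<rho> where "\<rho> \<in> ?C p" "\<rho> \<in> ?C q" by blast
      then have \<rho>: "\<rho> \<in> ?R" "\<rho> (fst p) = \<rho> (fst q)" "\<rho> (snd p) = \<rho> (snd q)"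
        by (auto simp: case_prod_beta)
      have "fst p \<in> X" "fst q \<in> X" "snd p \<in> X" "snd q \<in> X" using pq(1,2) assms(2) by auto
      then have "p = q"
        using \<rho>(2,3) inj_onD[OF rankingsD(1)[OF \<rho>(1)]] by (intro prod_eqI) blast+
      then show False using pq(3) by simp
    qed
  qed (use fin finite_rankings[OF assms(1)] in auto)
  also have "(\<Union>xy\<in>V \<times> (X - V). ?C xy)
      \<subseteq> {\<rho> \<in> ?R. item X \<rho> k \<notin> V \<and> item X \<rho> (Suc k) \<in> V}"
    using assms(2) item_ranking by fastforce
  then have "?c * card (\<Union>xy\<in>V \<times> (X - V). ?C xy)
      \<le> ?c * card {\<rho> \<in> ?R. item X \<rho> k \<notin> V \<and> item X \<rho> (Suc k) \<in> V}"
    by (intro mult_le_mono2 card_mono) (auto simp: finite_rankings[OF assms(1)])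
  finally show ?thesis .
qed

text \<open>An optimal \<open>\<sigma>\<close> that is inverted at two adjacent ranks of \<open>\<rho>\<close> becomes strictly better
  once these ranks are swapped; such swaps account for half of all sensitive edges.\<close>

lemma sum_sensitivity_ge:
  fixes F :: "('a \<Rightarrow> nat) set"
  assumes "finite X" "V \<subseteq> X" "finite F" "F \<noteq> {}"
    and sep: "\<And>\<sigma> y. \<sigma> \<in> F \<Longrightarrow> y \<in> X - V \<Longrightarrow> (\<forall>x\<in>V. \<sigma> y < \<sigma> x) \<or> (\<forall>x\<in>V. \<sigma> x < \<sigma> y)"
    and f: "\<And>\<rho>. f \<rho> = Min (Inv X \<rho> ` F)"
  shows "2 * card V * card (X - V) * card (rankings X)
    \<le> card X * (\<Sum>\<rho>\<in>rankings X. sensitivity X f \<rho> + 2)"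
proof (cases "card X \<le> 1")
  case True
  have "card V + card (X - V) = card X"
    using assms(1,2) card_Diff_subset[of V X] card_mono[of X V] finite_subset[of V X] by simp
  then have "card V = 0 \<or> card (X - V) = 0" using True by linarith
  then show ?thesis by (elim disjE) (simp_all only: mult_0 mult_0_right zero_le)
next
  case False
  let ?R = "rankings X" and ?K = "{1..<card X}"
  let ?D = "\<lambda>\<rho> k. item X \<rho> k \<notin> V \<and> item X \<rho> (Suc k) \<in> V"
  note finR = finite_rankings[OF assms(1)]
  have double: "(\<Sum>\<rho>\<in>?R. card {k \<in> ?K. Q \<rho> k}) = (\<Sum>k\<in>?K. card {\<rho> \<in> ?R. Q \<rho> k})" for Q
  proof -
    have "(\<Sum>\<rho>\<in>?R. card {k \<in> ?K. Q \<rho> k}) = (\<Sum>\<rho>\<in>?R. \<Sum>k\<in>?K. of_bool (Q \<rho> k))"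
      by (simp add: Int_def)
    also have "\<dots> = (\<Sum>k\<in>?K. \<Sum>\<rho>\<in>?R. of_bool (Q \<rho> k))" by (rule sum.swap)
    also have "\<dots> = (\<Sum>k\<in>?K. card {\<rho> \<in> ?R. Q \<rho> k})" using finR by (simp add: Int_def)
    finally show ?thesis .
  qed
  have down: "card {k \<in> ?K. ?D \<rho> k} \<le> Suc (card {k \<in> ?K. f (swap X k \<rho>) < f \<rho>})" if \<rho>: "\<rho> \<in> ?R" for \<rho>
  proof -
    have "f \<rho> \<in> Inv X \<rho> ` F" unfolding f using assms(3,4) by (intro Min_in) auto
    then obtain \<sigma> where \<sigma>: "\<sigma> \<in> F" "f \<rho> = Inv X \<rho> \<sigma>" by auto
    have "f (swap X k \<rho>) < f \<rho>" if k: "k \<in> ?K" "\<sigma> (item X \<rho> (Suc k)) < \<sigma> (item X \<rho> k)" for k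
    proof -
      have "f (swap X k \<rho>) \<le> Inv X (swap X k \<rho>) \<sigma>"
        unfolding f using assms(3) \<sigma>(1) by (intro Min_le) auto
      also have "\<dots> < f \<rho>" using Inv_swap[OF assms(1) \<rho> k] \<sigma>(2) by simp
      finally show ?thesis .
    qed
    then have "card {k \<in> ?K. \<sigma> (item X \<rho> (Suc k)) < \<sigma> (item X \<rho> k)} \<le> card {k \<in> ?K. f (swap X k \<rho>) < f \<rho>}"
      by (intro card_mono) auto
    with card_descents_ge[OF \<rho> sep[OF \<sigma>(1)]] show ?thesis by simp
  qed
  \<comment> \<open>The swap is an involution, so it maps rankings where it lowers \<open>f\<close>
    injectively to rankings where it raises \<open>f\<close>.\<close>
  have "card {\<rho> \<in> ?R. f (swap X k \<rho>) < f \<rho>} \<le> card {\<rho> \<in> ?R. f \<rho> < f (swap X k \<rho>)}" if k: "k \<in> ?K" for k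
  proof (rule card_inj_on_le)
    show "inj_on (swap X k) {\<rho> \<in> ?R. f (swap X k \<rho>) < f \<rho>}"
      using inj_on_subset[OF inj_on_relabel[OF swap_permutes[OF k]]] by auto
  qed (use finR k in \<open>auto simp: swap_swap swap_in_rankings\<close>)
  then have up: "(\<Sum>\<rho>\<in>?R. card {k \<in> ?K. f (swap X k \<rho>) < f \<rho>}) \<le> (\<Sum>\<rho>\<in>?R. card {k \<in> ?K. f \<rho> < f (swap X k \<rho>)})"
    unfolding double by (rule sum_mono)
  have "(card X - 1) * (card V * card (X - V) * card ?R) = (\<Sum>k\<in>?K. card V * card (X - V) * card ?R)"
    by simp
  also have "\<dots> \<le> (\<Sum>k\<in>?K. card X * (card X - 1) * card {\<rho> \<in> ?R. ?D \<rho> k})"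
    by (intro sum_mono card_boundary_rankings assms(1,2))
  also have "\<dots> = (card X - 1) * (card X * (\<Sum>\<rho>\<in>?R. card {k \<in> ?K. ?D \<rho> k}))"
    unfolding double by (simp add: sum_distrib_left mult_ac)
  finally have "card V * card (X - V) * card ?R \<le> card X * (\<Sum>\<rho>\<in>?R. card {k \<in> ?K. ?D \<rho> k})"
    using False by (simp del: mult.assoc)
  also have "(\<Sum>\<rho>\<in>?R. card {k \<in> ?K. ?D \<rho> k}) \<le> (\<Sum>\<rho>\<in>?R. Suc (card {k \<in> ?K. f (swap X k \<rho>) < f \<rho>}))"
    using down by (rule sum_mono)
  finally have "2 * (card V * card (X - V) * card ?R)
      \<le> card X * (2 * (\<Sum>\<rho>\<in>?R. Suc (card {k \<in> ?K. f (swap X k \<rho>) < f \<rho>})))" by simp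
  also have "2 * (\<Sum>\<rho>\<in>?R. Suc (card {k \<in> ?K. f (swap X k \<rho>) < f \<rho>}))
      = 2 * card ?R + 2 * (\<Sum>\<rho>\<in>?R. card {k \<in> ?K. f (swap X k \<rho>) < f \<rho>})"
    by (simp add: sum_Suc)
  also have "\<dots> \<le> 2 * card ?R + (\<Sum>\<rho>\<in>?R. card {k \<in> ?K. f (swap X k \<rho>) < f \<rho>} + card {k \<in> ?K. f \<rho> < f (swap X k \<rho>)})"
    using up by (simp add: sum.distrib)
  also have "(\<Sum>\<rho>\<in>?R. card {k \<in> ?K. f (swap X k \<rho>) < f \<rho>} + card {k \<in> ?K. f \<rho> < f (swap X k \<rho>)})
      = (\<Sum>\<rho>\<in>?R. sensitivity X f \<rho>)"
  proof (rule sum.cong[OF refl])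
    fix \<rho>
    have "{k \<in> ?K. f (swap X k \<rho>) \<noteq> f \<rho>} = {k \<in> ?K. f (swap X k \<rho>) < f \<rho>} \<union> {k \<in> ?K. f \<rho> < f (swap X k \<rho>)}"
      by auto
    then show "card {k \<in> ?K. f (swap X k \<rho>) < f \<rho>} + card {k \<in> ?K. f \<rho> < f (swap X k \<rho>)} = sensitivity X f \<rho>"
      unfolding sensitivity_def by (simp add: card_Un_disjoint disjoint_iff)
  qed
  also have "2 * card ?R + (\<Sum>\<rho>\<in>?R. sensitivity X f \<rho>) = (\<Sum>\<rho>\<in>?R. sensitivity X f \<rho> + 2)"
    by (simp only: sum.distrib sum_constant) simp
  finally show ?thesis by (simp only: mult.assoc mult_le_mono2)
qed

section \<open>From average sensitivity to query complexity\<close>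

lemma ranking_eq_card:
  assumes "\<rho> \<in> rankings X" "x \<in> X"
  shows "\<rho> x = Suc (card {y \<in> X. \<rho> y < \<rho> x})"
proof -
  have "\<rho> ` {y \<in> X. \<rho> y < \<rho> x} = {1..<\<rho> x}"
  proof (intro equalityI subsetI)
    fix i assume i: "i \<in> {1..<\<rho> x}"
    then have "i \<in> {1..card X}" using ranking_in[OF assms] by auto
    then show "i \<in> \<rho> ` {y \<in> X. \<rho> y < \<rho> x}"
      using i item_in[OF assms(1)] ranking_item[OF assms(1)]
      by (intro image_eqI[of _ _ "item X \<rho> i"]) auto
  qed (use ranking_in[OF assms(1)] in auto)
  moreover have "inj_on \<rho> {y \<in> X. \<rho> y < \<rho> x}"
    by (rule inj_on_subset[OF rankingsD(1)[OF assms(1)]]) auto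
  ultimately have "card {y \<in> X. \<rho> y < \<rho> x} = card {1..<\<rho> x}" by (metis card_image)
  then show ?thesis using ranking_in[OF assms] by simp
qed

lemma rankings_eqI:
  assumes "\<rho> \<in> rankings X" "\<rho>' \<in> rankings X"
    and "\<And>x y. x \<in> X \<Longrightarrow> y \<in> X \<Longrightarrow> \<rho> x < \<rho> y \<longleftrightarrow> \<rho>' x < \<rho>' y"
  shows "\<rho> = \<rho>'"
proof (rule extensionalityI[OF rankingsD(3)[OF assms(1)] rankingsD(3)[OF assms(2)]])
  fix x assume x: "x \<in> X"
  then have "{y \<in> X. \<rho> y < \<rho> x} = {y \<in> X. \<rho>' y < \<rho>' x}" using assms(3) by auto
  then show "\<rho> x = \<rho>' x" using ranking_eq_card[OF _ x] assms(1,2) by metis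
qed

text \<open>The algorithm asks the listed questions one after another. \<open>R\<close> holds the
  rankings consistent with the answers so far, and when the list is exhausted \<open>f\<close> is
  constant on \<open>R\<close>.\<close>

lemma ex_algorithm_comparing:
  assumes "set qs \<subseteq> X \<times> X"
    and "\<And>\<rho> \<rho>'. \<rho> \<in> R \<Longrightarrow> \<rho>' \<in> R \<Longrightarrow>
      (\<And>x y. (x, y) \<in> set qs \<Longrightarrow> \<rho> x < \<rho> y \<longleftrightarrow> \<rho>' x < \<rho>' y) \<Longrightarrow> f \<rho> = f \<rho>'"
  shows "\<exists>A. queries_within X A \<and> (\<forall>\<rho>\<in>R. run A \<rho> = f \<rho>)"
  using assms
proof (induction qs arbitrary: R)
  case Nil
  \<comment> \<open>If no ranking is left, this output is an arbitrary default.\<close>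
  have "f (SOME \<rho>. \<rho> \<in> R) = f \<rho>" if "\<rho> \<in> R" for \<rho>
    by (rule Nil(2)[OF _ that]) (use someI[of "\<lambda>\<rho>. \<rho> \<in> R", OF that] in simp_all)
  then show ?case by (intro exI[of _ "Output (f (SOME \<rho>. \<rho> \<in> R))"]) simp
next
  case (Cons q qs)
  obtain x y where q: "q = (x, y)" by fastforce
  have sub: "f \<rho> = f \<rho>'" if "\<rho> \<in> R" "\<rho>' \<in> R" "\<rho> x < \<rho> y \<longleftrightarrow> \<rho>' x < \<rho>' y"
    and qs: "\<And>a b. (a, b) \<in> set qs \<Longrightarrow> \<rho> a < \<rho> b \<longleftrightarrow> \<rho>' a < \<rho>' b" for \<rho> \<rho>'
  proof (rule Cons.prems(2)[OF that(1,2)])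
    fix a b assume "(a, b) \<in> set (q # qs)"
    then show "\<rho> a < \<rho> b \<longleftrightarrow> \<rho>' a < \<rho>' b" using that(3) qs[of a b] q by fastforce
  qed
  have "set qs \<subseteq> X \<times> X" using Cons.prems(1) by simp
  note IH = Cons.IH[OF this]
  have "\<exists>A. queries_within X A \<and> (\<forall>\<rho>\<in>{\<rho> \<in> R. \<rho> x < \<rho> y}. run A \<rho> = f \<rho>)"
    by (rule IH, rule sub) simp_all
  then obtain A where A: "queries_within X A" "\<forall>\<rho>\<in>{\<rho> \<in> R. \<rho> x < \<rho> y}. run A \<rho> = f \<rho>" by blast
  have "\<exists>B. queries_within X B \<and> (\<forall>\<rho>\<in>{\<rho> \<in> R. \<not> \<rho> x < \<rho> y}. run B \<rho> = f \<rho>)"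
    by (rule IH, rule sub) simp_all
  then obtain B where B: "queries_within X B" "\<forall>\<rho>\<in>{\<rho> \<in> R. \<not> \<rho> x < \<rho> y}. run B \<rho> = f \<rho>" by blast
  show ?case
    using A B Cons.prems(1) q by (intro exI[of _ "Query x y A B"]) auto
qed

text \<open>Comparing all pairs determines the ranking, so some algorithm solves the problem and the
  \<open>LEAST\<close> ranges over a nonempty set.\<close>

lemma query_complexity_attained:
  assumes "finite X"
  shows "\<exists>A. solves A X f \<and> (\<forall>\<rho>\<in>rankings X. num_queries A \<rho> \<le> query_complexity X f)"
proof -
  obtain qs where qs: "set qs = X \<times> X" using finite_list[of "X \<times> X"] assms by auto
  have "\<exists>A. queries_within X A \<and> (\<forall>\<rho>\<in>rankings X. run A \<rho> = f \<rho>)"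
  proof (rule ex_algorithm_comparing)
    fix \<rho> \<rho>' assume "\<rho> \<in> rankings X" "\<rho>' \<in> rankings X"
      "\<And>x y. (x, y) \<in> set qs \<Longrightarrow> \<rho> x < \<rho> y \<longleftrightarrow> \<rho>' x < \<rho>' y"
    then show "f \<rho> = f \<rho>'" using rankings_eqI[of \<rho> X \<rho>'] qs by auto
  qed (use qs in simp)
  then have "\<exists>q A. solves A X f \<and> q = Max (num_queries A ` rankings X)"
    by (auto simp: solves_def)
  from LeastI_ex[OF this] obtain A where
    "solves A X f" "query_complexity X f = Max (num_queries A ` rankings X)"
    unfolding query_complexity_def by blast
  then show ?thesis using finite_rankings[OF assms] by (auto intro!: exI[of _ A] Max_ge)
qed

section \<open>Convexity of the Gamma function\<close>

lemma convex_on_Gamma_real: "convex_on {0<..} (Gamma :: real \<Rightarrow> real)"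
  unfolding convex_on_def
proof (intro conjI ballI allI impI)
  fix x y u v :: real
  assume xy: "x \<in> {0<..}" "y \<in> {0<..}" and uv: "0 \<le> u" "0 \<le> v" "u + v = 1"
  define z where "z = u *\<^sub>R x + v *\<^sub>R y"
  have z: "z > 0" using xy uv unfolding z_def
    by (metis convex_def convex_real_interval(3) greaterThan_iff convexD)
  have "ln (Gamma z) \<le> u * ln (Gamma x) + v * ln (Gamma y)"
    using log_convex_Gamma_real xy uv unfolding convex_on_def z_def by simp
  then have "exp (ln (Gamma z)) \<le> exp (u *\<^sub>R ln (Gamma x) + v *\<^sub>R ln (Gamma y))" by simp
  also have "\<dots> \<le> u * exp (ln (Gamma x)) + v * exp (ln (Gamma y))"
    using exp_convex uv unfolding convex_on_def by blast
  finally show "Gamma (u *\<^sub>R x + v *\<^sub>R y) \<le> u * Gamma x + v * Gamma y"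
    using xy z by (simp add: Gamma_real_pos z_def)
qed simp

text \<open>\<open>Gamma\<close> is not monotone on \<open>[1, 2]\<close>. Instead,
  \<open>x + 1\<close> lies between 1 and \<open>z + 1\<close>, and a convex function is bounded
  there by its larger endpoint value, where \<open>Gamma 1 = 1\<close>.\<close>

lemma Gamma_real_le_max:
  fixes x z :: real
  assumes "0 \<le> x" "x \<le> z"
  shows "Gamma (x + 1) \<le> max 1 (Gamma (z + 1))"
proof (cases "z = 0")
  case False
  define u where "u = x / z"
  have u: "0 \<le> u" "u \<le> 1" "u * z = x" using assms False by (auto simp: u_def)
  then have "Gamma ((1 - u) *\<^sub>R 1 + u *\<^sub>R (z + 1)) \<le> (1 - u) * Gamma 1 + u * Gamma (z + 1)"
    using assms by (intro convex_onD[OF convex_on_Gamma_real]) auto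
  also have "(1 - u) *\<^sub>R 1 + u *\<^sub>R (z + 1) = x + 1" using u(3) by (simp add: algebra_simps)
  also have "(1 - u) * Gamma 1 + u * Gamma (z + 1)
      \<le> (1 - u) * max 1 (Gamma (z + 1)) + u * max 1 (Gamma (z + 1))"
    using u by (intro add_mono mult_left_mono) auto
  also have "\<dots> = max 1 (Gamma (z + 1))" by (simp add: algebra_simps)
  finally show ?thesis .
qed (use assms in simp)

lemma Gamma_real_le_1: "0 \<le> x \<Longrightarrow> x \<le> 1 \<Longrightarrow> Gamma (x + 1 :: real) \<le> 1"
  using Gamma_real_le_max[of x 1] Gamma_fact[of 1, where 'a = real] by simp

text \<open>Jensen's inequality, with \<open>Gamma (m + 1) = fact m\<close> at natural
  numbers.\<close>

lemma Gamma_real_mean_le: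
  fixes g :: "'b \<Rightarrow> nat"
  assumes "finite R" "R \<noteq> {}"
  shows "Gamma ((\<Sum>\<rho>\<in>R. real (g \<rho>)) / card R + 1) \<le> (\<Sum>\<rho>\<in>R. fact (g \<rho>)) / card R"
proof -
  let ?c = "real (card R)"
  have c: "?c > 0" using assms by (simp add: card_gt_0_iff)
  have "Gamma (\<Sum>\<rho>\<in>R. (1 / ?c) *\<^sub>R (1 + real (g \<rho>))) \<le> (\<Sum>\<rho>\<in>R. (1 / ?c) * Gamma (1 + real (g \<rho>)))"
    using assms c by (intro convex_on_sum[OF _ _ convex_on_Gamma_real]) auto
  also have "\<dots> = (\<Sum>\<rho>\<in>R. fact (g \<rho>)) / ?c"
    by (simp add: Gamma_fact sum_divide_distrib)
  also have "(\<Sum>\<rho>\<in>R. (1 / ?c) *\<^sub>R (1 + real (g \<rho>))) = (\<Sum>\<rho>\<in>R. real (g \<rho>)) / ?c + 1"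
    using c by (simp add: add_divide_distrib sum.distrib sum_divide_distrib)
  finally show ?thesis .
qed

text \<open>Because \<open>Gamma\<close> is not monotone, the bound is formulated for every
  \<open>x\<close> up to the quotient; the degree bound uses a smaller \<open>x\<close> than the
  subtree bound.\<close>

lemma log_Gamma_le_query_complexity:
  fixes F :: "('a \<Rightarrow> nat) set" and x :: real
  assumes X: "finite X" "V \<subseteq> X" and F: "finite F" "F \<noteq> {}"
    and sep: "\<And>\<sigma> y. \<sigma> \<in> F \<Longrightarrow> y \<in> X - V \<Longrightarrow> (\<forall>x\<in>V. \<sigma> y < \<sigma> x) \<or> (\<forall>x\<in>V. \<sigma> x < \<sigma> y)"
    and f: "\<And>\<rho>. f \<rho> = Min (Inv X \<rho> ` F)"
    and x: "0 \<le> x" "x \<le> real (card V) * (real (card X) - real (card V)) / real (card X)"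
  shows "log 2 (Gamma (x + 1)) \<le> real (query_complexity X f)"
proof -
  define q where "q = query_complexity X f"
  define t where "t = real (card V) * (real (card X) - real (card V)) / real (card X)"
  have "Gamma (x + 1) \<le> 2 ^ q"
  proof (cases "t \<le> 1")
    case True
    have "Gamma (x + 1) \<le> 1" using x True by (intro Gamma_real_le_1) (auto simp: t_def)
    also have "1 \<le> (2 :: real) ^ q" by simp
    finally show ?thesis .
  next
    case False
    let ?R = "rankings X"
    define z where "z = (\<Sum>\<rho>\<in>?R. real (Suc (sensitivity X f \<rho>))) / card ?R"
    have n: "card X > 0" using False by (cases "card X = 0") (auto simp: t_def)
    have "(0::nat) < fact (card X)" by simp
    then have c: "card ?R > 0" using card_rankings_ge[OF X(1)] by linarith
    have "real (2 * card V * card (X - V) * card ?R)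
        \<le> real (card X * (\<Sum>\<rho>\<in>?R. sensitivity X f \<rho> + 2))"
      by (simp only: of_nat_le_iff) (rule sum_sensitivity_ge[OF X F sep f])
    moreover have "real (card (X - V)) = real (card X) - real (card V)"
      using X finite_subset[OF X(2,1)] by (simp add: card_Diff_subset of_nat_diff card_mono)
    moreover have "real (\<Sum>\<rho>\<in>?R. sensitivity X f \<rho> + 2) = (z + 1) * card ?R"
      using c by (simp add: z_def field_simps sum.distrib)
    moreover have "real (card V) * (real (card X) - real (card V)) = t * real (card X)"
      using n by (simp add: t_def)
    ultimately have "2 * (t * card X) * card ?R \<le> card X * ((z + 1) * card ?R)"
      by (simp only: of_nat_mult of_nat_numeral mult.assoc) (simp flip: mult.assoc)
    then have "(2 * t) * (real (card X) * card ?R) \<le> (z + 1) * (real (card X) * card ?R)"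
      by (simp only: mult_ac)
    then have "2 * t \<le> z + 1"
      by (rule mult_right_le_imp_le) (use n c in simp)
    \<comment> \<open>Here \<open>t > 1\<close> gives
      \<open>z \<ge> 2 * t - 1 > t \<ge> x\<close>.\<close>
    then have "x \<le> z" using x(2) False by (simp add: t_def)
    obtain A where A: "solves A X f" "\<And>\<rho>. \<rho> \<in> ?R \<Longrightarrow> num_queries A \<rho> \<le> q"
      using query_complexity_attained[OF X(1), of f] by (auto simp: q_def)
    have "Gamma (z + 1) \<le> (\<Sum>\<rho>\<in>?R. fact (Suc (sensitivity X f \<rho>))) / card ?R"
      unfolding z_def using finite_rankings[OF X(1)] c by (intro Gamma_real_mean_le) auto
    also have "(\<Sum>\<rho>\<in>?R. fact (Suc (sensitivity X f \<rho>)) :: real)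
        = real (\<Sum>\<rho>\<in>?R. fact (Suc (sensitivity X f \<rho>)))"
      by (simp only: of_nat_sum of_nat_fact)
    also have "real (\<Sum>\<rho>\<in>?R. fact (Suc (sensitivity X f \<rho>))) / card ?R \<le> real (2 ^ q * card ?R) / card ?R"
    proof (intro divide_right_mono)
      have "(\<Sum>\<rho>\<in>?R. fact (Suc (sensitivity X f \<rho>))) \<le> 2 ^ q * (fact (card X) :: nat)"
        by (rule sensitivity_lemma[OF X(1) A])
      also have "\<dots> \<le> 2 ^ q * card ?R" using card_rankings_ge[OF X(1)] by (rule mult_le_mono2)
      finally show "real (\<Sum>\<rho>\<in>?R. fact (Suc (sensitivity X f \<rho>))) \<le> real (2 ^ q * card ?R)"
        by (simp only: of_nat_le_iff)
    qed simp
    finally have "Gamma (z + 1) \<le> 2 ^ q" using c by simp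
    moreover have "(1 :: real) \<le> 2 ^ q" by simp
    ultimately show ?thesis using Gamma_real_le_max[OF x(1) \<open>x \<le> z\<close>] by linarith
  qed
  moreover have "Gamma (x + 1) > 0" using x(1) by (intro Gamma_real_pos) auto
  ultimately show ?thesis by (simp add: log_le_iff powr_realpow q_def)
qed

section \<open>Trees\<close>

lemma mset_leaves_ordering: "ordering_of T T' \<Longrightarrow> mset (leaves T') = mset (leaves T)"
proof (induction rule: ordering_of.induct)
  case (2 ss ts us)
  have "list_all2 (\<lambda>s u. mset (leaves s) = mset (leaves u)) ss us"
    using 2(2) by (rule list_all2_mono) simp
  then have "map (mset \<circ> leaves) ss = map (mset \<circ> leaves) us"
    by (auto simp: list_all2_conv_all_nth intro: nth_equalityI)
  then have "mset (leaves (Node us)) = sum_list (map (mset \<circ> leaves) ss)"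
    by (simp add: mset_concat)
  also have "\<dots> = sum_mset (image_mset (mset \<circ> leaves) (mset ss))"
    by (metis mset_map sum_mset_sum_list)
  also have "\<dots> = mset (leaves (Node ts))"
    unfolding 2(1) by (simp add: mset_concat flip: mset_map sum_mset_sum_list)
  finally show ?case .
qed simp

lemma ordering_of_refl: "ordering_of T T"
proof (induction T)
  case (Node ts)
  then have "list_all2 ordering_of ts ts" by (simp add: list_all2_same)
  then show ?case by (intro ordering_of.intros(2)[OF refl])
qed (rule ordering_of.intros)

lemma leaf_set_node: "v \<in> nodes T \<Longrightarrow> leaf_set v \<subseteq> leaf_set T"
  by (induction T rule: nodes.induct) auto

text \<open>Reordering moves whole subtrees, so the leaves below \<open>v\<close> stay together in
  one block. Only the set of the block is fixed, since \<open>v\<close> may itself be reordered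
  inside.\<close>

lemma node_leaves_contiguous:
  "ordering_of T T' \<Longrightarrow> v \<in> nodes T \<Longrightarrow>
    \<exists>as bs cs. leaves T' = as @ bs @ cs \<and> set bs = leaf_set v"
proof (induction rule: ordering_of.induct)
  case (1 x)
  then show ?case by (intro exI[of _ "[]"] exI[of _ "[x]"]) simp
next
  case (2 ss ts us)
  have ord: "ordering_of (Node ts) (Node us)"
    using 2(2) by (intro ordering_of.intros(2)[OF 2(1)]) (auto elim: list_all2_mono)
  show ?case
  proof (cases "v = Node ts")
    case True
    then have "set (leaves (Node us)) = leaf_set v"
      using mset_leaves_ordering[OF ord] by (metis set_mset_mset)
    then show ?thesis by (intro exI[of _ "[]"] exI[of _ "leaves (Node us)"]) simp
  next
    case False
    then obtain t where "t \<in> set ts" "v \<in> nodes t" using 2(3) by auto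
    then have "t \<in> set ss" using 2(1) by (metis set_mset_mset)
    then obtain i where i: "i < length ss" "ss ! i = t" by (auto simp: in_set_conv_nth)
    then have iu: "i < length us" using 2(2) by (simp add: list_all2_lengthD)
    obtain as bs cs where abc: "leaves (us ! i) = as @ bs @ cs" "set bs = leaf_set v"
      using list_all2_nthD[OF 2(2) i(1)] i(2) \<open>v \<in> nodes t\<close> by blast
    have "leaves (Node us) = concat (map leaves (take i us @ us ! i # drop (Suc i) us))"
      using iu by (simp flip: id_take_nth_drop)
    also have "\<dots> = (concat (map leaves (take i us)) @ as) @ bs @ (cs @ concat (map leaves (drop (Suc i) us)))"
      using abc(1) by simp
    finally show ?thesis using abc(2) by blast
  qed
qed

text \<open>A leaf outside the block of \<open>v\<close> comes either before or after all of
  it.\<close>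

lemma leaf_ranking_separates:
  assumes "distinct (leaves T)" "ordering_of T T'" "v \<in> nodes T" "y \<in> leaf_set T - leaf_set v"
  shows "(\<forall>x\<in>leaf_set v. leaf_ranking T' y < leaf_ranking T' x) \<or>
    (\<forall>x\<in>leaf_set v. leaf_ranking T' x < leaf_ranking T' y)"
proof -
  obtain as bs cs where l: "leaves T' = as @ bs @ cs" and bs: "set bs = leaf_set v"
    using node_leaves_contiguous[OF assms(2,3)] by blast
  have X: "leaf_set T' = leaf_set T" using mset_leaves_ordering[OF assms(2)] by (metis set_mset_mset)
  define pos where "pos x xs = length (takeWhile (\<lambda>z. z \<noteq> x) xs)" for x :: 'a and xs
  have pos_in: "pos x (xs @ ys) < length xs" if "x \<in> set xs" for x xs ys
    using that by (induction xs) (auto simp: pos_def)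
  have pos_notin: "pos x (xs @ ys) = length xs + pos x ys" if "x \<notin> set xs" for x xs ys
    using that by (induction xs) (auto simp: pos_def)
  have rank: "leaf_ranking T' x = Suc (pos x (as @ bs @ cs))" if "x \<in> leaf_set T" for x
    using that X by (simp add: leaf_ranking_def pos_def l)
  have "distinct (as @ bs @ cs)"
    using assms(1) mset_leaves_ordering[OF assms(2)] l by (metis mset_eq_imp_distinct_iff)
  then have x: "x \<in> leaf_set T" "x \<notin> set as" "x \<in> set bs" if "x \<in> leaf_set v" for x
    using that leaf_set_node[OF assms(3)] bs by auto
  have y: "y \<in> leaf_set T" "y \<notin> set bs" using assms(4) bs by auto
  show ?thesis
  proof (cases "y \<in> set as")
    case True
    have "leaf_ranking T' y < leaf_ranking T' x" if "x \<in> leaf_set v" for x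
      using x[OF that] y pos_in[OF True] pos_notin[of x as] by (simp add: rank trans_less_add1)
    then show ?thesis by blast
  next
    case False
    have "leaf_ranking T' x < leaf_ranking T' y" if "x \<in> leaf_set v" for x
      using x[OF that] y False pos_in[of x bs cs] pos_notin[of x as] pos_notin[of y as] pos_notin[of y bs]
      by (simp add: rank trans_less_add1)
    then show ?thesis by blast
  qed
qed

lemma MInv_eq:
  "MInv T \<rho> = Min (Inv (leaf_set T) \<rho> ` leaf_ranking ` {T'. ordering_of T T'})"
proof -
  have "{Inv (leaf_set T) \<rho> (leaf_ranking T') | T'. ordering_of T T'}
      = Inv (leaf_set T) \<rho> ` leaf_ranking ` {T'. ordering_of T T'}" by blast
  then show ?thesis by (simp add: MInv_def)
qed

text \<open>The induced ranks are bounded in terms of the number of leaves, so \<open>MInv\<close>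
  is a minimum over a finite set.\<close>

lemma finite_leaf_rankings: "finite (leaf_ranking ` {T'. ordering_of T T'})"
proof (rule finite_subset)
  show "leaf_ranking ` {T'. ordering_of T T'} \<subseteq> leaf_set T \<rightarrow>\<^sub>E {..Suc (length (leaves T))}"
  proof (clarify)
    fix T' assume "ordering_of T T'"
    then have "leaf_set T' = leaf_set T" "length (leaves T') = length (leaves T)"
      using mset_leaves_ordering by (metis set_mset_mset, metis mset_leaves_ordering mset_eq_length)
    then show "leaf_ranking T' \<in> leaf_set T \<rightarrow>\<^sub>E {..Suc (length (leaves T))}"
      using length_takeWhile_le[of _ "leaves T'"] by (auto simp: leaf_ranking_def)
  qed
qed (intro finite_PiE, auto)

lemma distinct_leaves_node: "distinct (leaves T) \<Longrightarrow> v \<in> nodes T \<Longrightarrow> distinct (leaves v)"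
proof (induction T rule: nodes.induct)
  case (2 ts)
  then show ?case by (auto simp: distinct_concat_iff distinct_map)
qed auto

lemma finite_nodes: "finite (nodes T)"
  by (induction T rule: nodes.induct) auto

lemma self_in_nodes: "T \<in> nodes T"
  by (cases T) auto

text \<open>Descend to a child with the most leaves until the leaf count drops to at most
  \<open>k * n / (k + 1)\<close>; the last step loses at most a factor \<open>k\<close>.\<close>

lemma balanced_node_exists:
  fixes k n :: nat
  assumes "\<forall>u\<in>nodes T. node_degree u \<le> k" "k + 1 \<le> k * n" "k * n < (k + 1) * length (leaves T)"
  shows "\<exists>v\<in>nodes T. n \<le> (k + 1) * length (leaves v) \<and> (k + 1) * length (leaves v) \<le> k * n"
  using assms(1,3)
proof (induction T rule: nodes.induct)
  case (1 x)
  \<comment> \<open>A single leaf would give \<open>k * n < k + 1\<close>, contrary to the second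
    assumption.\<close>
  then show ?case using assms(2) by simp
next
  case (2 ts)
  let ?m = "length (leaves (Node ts))"
  have m: "?m = (\<Sum>t\<leftarrow>ts. length (leaves t))"
    by (simp add: length_concat comp_def)
  \<comment> \<open>Otherwise each child falls short of a \<open>1 / k\<close> share by at least one
    unit after scaling by \<open>k\<close>. Summing over at most \<open>k\<close> children then
    leaves no children at all.\<close>
  have "\<exists>t\<in>set ts. ?m \<le> k * length (leaves t)"
  proof (rule ccontr)
    assume "\<not> ?thesis"
    then have less: "k * length (leaves t) + 1 \<le> ?m" if "t \<in> set ts" for t using that by force
    have "k * ?m + length ts = (\<Sum>t\<leftarrow>ts. k * length (leaves t) + 1)"
      unfolding m by (induction ts) (auto simp: algebra_simps)
    also have "\<dots> \<le> (\<Sum>t\<leftarrow>ts. ?m)" using less by (intro sum_list_mono) 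
    also have "\<dots> = length ts * ?m" by (simp add: sum_list_triv)
    also have "\<dots> \<le> k * ?m" using 2(2) by (intro mult_le_mono1) simp
    finally have "ts = []" by simp
    then show False using 2(3) by simp
  qed
  then obtain t where t: "t \<in> set ts" "?m \<le> k * length (leaves t)" by blast
  have "k * n < k * ((k + 1) * length (leaves t))"
    using mult_le_mono2[OF t(2), of "k + 1"] 2(3) by (simp only: mult_ac)
  then have n: "n \<le> (k + 1) * length (leaves t)" by simp
  show ?case
  proof (cases "(k + 1) * length (leaves t) \<le> k * n")
    case True
    then show ?thesis using n t(1) self_in_nodes[of t] by auto
  next
    case False
    have "\<exists>v\<in>nodes t. n \<le> (k + 1) * length (leaves v) \<and> (k + 1) * length (leaves v) \<le> k * n"
      using 2(2) t(1) False by (intro 2(1)) auto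
    then show ?thesis using t(1) by auto
  qed
qed

theorem mainTheorem1:
  fixes T :: "'a rtree" and n k :: nat
  assumes "rooted_tree T"
    and "n = card (leaf_set T)"
    and "k = tree_degree T"
  shows "(\<forall>v\<in>nodes T. \<forall>l::nat. l = card (leaf_set v) \<longrightarrow>
            real (query_complexity (leaf_set T) (MInv T))
              \<ge> log 2 (Gamma (real l * (real n - real l) / real n + 1)))
       \<and> real (query_complexity (leaf_set T) (MInv T))
              \<ge> log 2 (Gamma (real k / (real k + 1)^2 * real n + 1))"
proof -
  let ?X = "leaf_set T" and ?F = "leaf_ranking ` {T'. ordering_of T T'}"
  let ?q = "real (query_complexity ?X (MInv T))"
  have bound: "log 2 (Gamma (x + 1)) \<le> ?q"
    if "v \<in> nodes T" "0 \<le> x" "x \<le> real (card (leaf_set v)) * (real n - real (card (leaf_set v))) / real n" for v x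
  proof (rule log_Gamma_le_query_complexity)
    show "?F \<noteq> {}" using ordering_of_refl by auto
    show "(\<forall>x\<in>leaf_set v. \<sigma> y < \<sigma> x) \<or> (\<forall>x\<in>leaf_set v. \<sigma> x < \<sigma> y)"
      if "\<sigma> \<in> ?F" "y \<in> ?X - leaf_set v" for \<sigma> y
      using that assms(1) leaf_ranking_separates[OF _ _ \<open>v \<in> nodes T\<close>]
      unfolding rooted_tree_def by blast
    show "leaf_set v \<subseteq> ?X" using \<open>v \<in> nodes T\<close> by (rule leaf_set_node)
  qed (use that assms(2) MInv_eq finite_leaf_rankings in auto)
  have "real l * (real n - real l) / real n \<ge> 0" if "v \<in> nodes T" "l = card (leaf_set v)" for v l
    using that assms(2) leaf_set_node[OF that(1)] by (simp add: card_mono)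
  then have first: "log 2 (Gamma (real l * (real n - real l) / real n + 1)) \<le> ?q"
    if "v \<in> nodes T" "l = card (leaf_set v)" for v l
    using that by (intro bound[of v]) auto
  define x where "x = real k / (real k + 1)^2 * real n"
  have x0: "0 \<le> x" by (simp add: x_def)
  have "log 2 (Gamma (x + 1)) \<le> ?q"
  \<comment> \<open>Too few leaves for a balanced node make the argument \<open>x\<close> at most 1,
    and the bound is then trivial.\<close>
  proof (cases "k + 1 \<le> k * n")
    case False
    then have "real (k * n) \<le> real (k + 1)" by (simp only: of_nat_le_iff)
    also have "\<dots> \<le> (real k + 1)^2" by (simp add: power2_eq_square algebra_simps)
    finally have "x \<le> 1" by (simp add: x_def divide_le_eq)
    then have "Gamma (x + 1) \<le> 1" using x0 by (intro Gamma_real_le_1)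
    moreover have "Gamma (x + 1) > 0" using x0 by (intro Gamma_real_pos) auto
    ultimately have "log 2 (Gamma (x + 1)) \<le> 0" by simp
    then show ?thesis by simp
  next
    case True
    have dist: "distinct (leaves T)" using assms(1) by (simp add: rooted_tree_def)
    then have n: "n = length (leaves T)" using assms(2) by (simp add: distinct_card)
    have "n > 0" using True by (cases n) auto
    have deg: "\<forall>u\<in>nodes T. node_degree u \<le> k"
      using finite_nodes[of T] assms(3) by (auto simp: tree_degree_def intro!: Max_ge)
    have "\<exists>v\<in>nodes T. n \<le> (k + 1) * length (leaves v) \<and> (k + 1) * length (leaves v) \<le> k * n"
      using True \<open>n > 0\<close> n by (intro balanced_node_exists[OF deg]) auto
    then obtain v where v: "v \<in> nodes T" "n \<le> (k + 1) * length (leaves v)" "(k + 1) * length (leaves v) \<le> k * n"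
      by blast
    define l where "l = card (leaf_set v)"
    have "l = length (leaves v)" using distinct_leaves_node[OF dist v(1)] by (simp add: l_def distinct_card)
    then have a: "real n \<le> (real k + 1) * real l" "(real k + 1) * real l \<le> real k * real n"
      using v(2,3) by (metis of_nat_mono of_nat_mult of_nat_Suc Suc_eq_plus1 add.commute)+
    \<comment> \<open>With \<open>a = (k + 1) * l\<close>, expanding
      \<open>(a - n) * (k * n - a) \<ge> 0\<close> yields
      \<open>(k + 1)^2 * l * (n - l) \<ge> k * n^2\<close>, which is the required comparison of
      \<open>x\<close> with the quotient for \<open>l\<close>.\<close>
    then have "0 \<le> ((real k + 1) * real l - real n) * (real k * real n - (real k + 1) * real l)"
      by (intro mult_nonneg_nonneg) auto
    then have "real k * real n * real n \<le> real l * (real n - real l) * (real k + 1)^2"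
      by (simp add: power2_eq_square algebra_simps)
    then have "x \<le> real l * (real n - real l) / real n"
      using \<open>n > 0\<close> by (simp add: x_def field_simps)
    then show ?thesis using x0 v(1) by (intro bound) (auto simp: l_def)
  qed
  then show ?thesis using first by (auto simp: x_def)
qed

end
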